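(* Let $\Lambda$ be a non-ordinary numerical semigroup with conductor $c$, let $\sigma$ be a right generator of $\Lambda$, and let $\tilde\Lambda=\Lambda\setminus\{\sigma\}$, $\omega=\omega(\Lambda)$, $\tilde\omega=\omega(\tilde\Lambda)$. - If $\sigma=c$, then $\tilde\omega=\omega$, $\overline{\tilde\Lambda}=\overline{\Lambda}$, and $c(\overline{\tilde\Lambda})=c(\overline{\Lambda})$. - If $\sigma=c+1$, then $\tilde\omega=\gcd(\omega,c)$, $\overline{\tilde\Lambda}=\frac{\omega}{\tilde\omega}\overline{\Lambda}+\frac{c}{\tilde\omega}\mathbb{N}_0$, and $$c(\overline{\tilde\Lambda})\leq c(\overline{\Lambda})\frac{\omega}{\tilde\omega}+\left(\frac{c}{\tilde\omega}-1\right)\left(\frac{\omega}{\tilde\omega}-1\right).$$ - If $\sigma>c+1$, then $\tilde\omega=1$, $\overline{\tilde\Lambda}=\omega\overline{\Lambda}+\Lambda_{\{c,\dots,\sigma-1\}}$, and $$c(\overline{\tilde\Lambda})\leq c(\overline{\Lambda})\,\omega+\left(\left\lfloor\frac{\omega-2}{\sigma-c-1}\right\rfloor+1\right)c.$$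
   Context: A numerical semigroup is a subset $\Lambda\subseteq\mathbb{N}_0$ containing $0$, closed under addition, with finite complement in $\mathbb{N}_0$. The Frobenius number is the largest element of $\mathbb{N}_0\setminus\Lambda$ (and $-1$ for $\mathbb{N}_0$). The conductor $c(\Lambda)$ is the smallest integer $c\geq0$ such that all integers $n\geq c$ belong to $\Lambda$. $\Lambda$ is ordinary if its gaps are all consecutive starting from $1$ (i.e. $\Lambda=\{0\}\cup\{n:n\geq m\}$ for some $m\geq 1$). The set of left elements $L(\Lambda)$ is the set of elements of $\Lambda$ smaller than the Frobenius number. The right generators of $\Lambda$ are the elements of its unique minimal generating set that are not left elements (equivalently, those $\geq c(\Lambda)$). If $\sigma$ is a right generator, $\Lambda\setminus\{\sigma\}$ is a numerical semigroup. For non-ordinary $\Lambda$, $\omega(\Lambda)=\gcd(L(\Lambda))$, and the shrinking of $\Lambda$ is the numerical semigroup $\overline{\Lambda}=\left\langle\frac{L(\Lambda)}{\omega(\Lambda)}\right\rangle$ generated by the left elements divided by their gcd. For sets $A,B$ of integers, $A+B=\{a+b:a\in A,\ b\in B\}$, and for an integer $k$, $kA=\{ka:a\in A\}$. $\Lambda_{\{i,\dots,j\}}$ denotes the submonoid of $\mathbb{N}_0$ generated by the interval $\{i,i+1,\dots,j\}$. The symbol $\lfloor\cdot\rfloor$ is the usual floor of a rational number (so $\lfloor -1/n\rfloor=-1$ for $n\geq1$). *)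

theory Defs
  imports Complex_Main HOL.Hull "HOL-Library.Set_Algebras"
begin

definition nat_submonoid :: "nat set \<Rightarrow> bool" where
  "nat_submonoid S \<longleftrightarrow> 0 \<in> S \<and> (\<forall>a\<in>S. \<forall>b\<in>S. a + b \<in> S)"

abbreviation generated :: "nat set \<Rightarrow> nat set" where
  "generated A \<equiv> nat_submonoid hull A"

definition numerical_semigroup :: "nat set \<Rightarrow> bool" where
  "numerical_semigroup S \<longleftrightarrow> nat_submonoid S \<and> finite (UNIV - S)"

definition frobenius :: "nat set \<Rightarrow> int" where
  "frobenius S = (if S = UNIV then -1 else int (Max (UNIV - S)))"

definition conductor :: "nat set \<Rightarrow> nat" where
  "conductor S = (LEAST c. \<forall>n\<ge>c. n \<in> S)"

definition ordinary :: "nat set \<Rightarrow> bool" where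
  "ordinary S \<longleftrightarrow> (\<exists>m\<ge>1. S = {0} \<union> {m..})"

definition left_elements :: "nat set \<Rightarrow> nat set" where
  "left_elements S = {s \<in> S. int s < frobenius S}"

definition minimal_generating_set :: "nat set \<Rightarrow> nat set \<Rightarrow> bool" where
  "minimal_generating_set S G \<longleftrightarrow>
     generated G = S \<and> (\<forall>H. H \<subset> G \<longrightarrow> generated H \<noteq> S)"

lemma zero_in_generated: "0 \<in> generated A"
  and add_in_generated: "a \<in> generated A \<Longrightarrow> b \<in> generated A \<Longrightarrow> a + b \<in> generated A"
  by (simp_all add: hull_def nat_submonoid_def)

lemma ex1_minimal_generating_set:
  assumes S: "nat_submonoid S"
  shows "\<exists>!G. minimal_generating_set S G"
proof -
  define I where "I = {s \<in> S. s \<noteq> 0 \<and> (\<forall>a\<in>S. \<forall>b\<in>S. s = a + b \<longrightarrow> a = 0 \<or> b = 0)}"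
  have "I \<subseteq> S" by (auto simp: I_def)
  then have sub: "generated I \<subseteq> S" using S by (rule hull_minimal)
  have "s \<in> generated I" if "s \<in> S" for s
    using that
  proof (induction s rule: less_induct)
    case (less s)
    consider "s = 0" | "s \<in> I"
      | a b where "a \<in> S" "b \<in> S" "s = a + b" "a \<noteq> 0" "b \<noteq> 0"
      using less.prems unfolding I_def by blast
    then show ?case
    proof cases
      case 1
      then show ?thesis by (simp add: zero_in_generated)
    next
      case 2
      then show ?thesis by (rule hull_inc)
    next
      case 3
      then have "a \<in> generated I" "b \<in> generated I" using less.IH by auto
      then show ?thesis using 3 by (simp add: add_in_generated)
    qed
  qed
  with sub have gen: "generated I = S" by auto
  have least: "I \<subseteq> H" if H: "generated H = S" for H
  proof (rule subsetI, rule ccontr)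
    fix s assume s: "s \<in> I" "s \<notin> H"
    have "H \<subseteq> S" using H hull_subset[of H nat_submonoid] by simp
    then have "H \<subseteq> S - {s}" using s by auto
    moreover have "nat_submonoid (S - {s})"
      unfolding nat_submonoid_def
    proof (intro conjI ballI)
      show "0 \<in> S - {s}"
        using S s by (simp add: nat_submonoid_def I_def)
    next
      fix a b assume ab: "a \<in> S - {s}" "b \<in> S - {s}"
      then have "a + b \<in> S" using S by (simp add: nat_submonoid_def)
      moreover have "a + b \<noteq> s"
      proof
        assume "a + b = s"
        then have "a = 0 \<or> b = 0" using s ab unfolding I_def by blast
        then show False using \<open>a + b = s\<close> ab by auto
      qed
      ultimately show "a + b \<in> S - {s}" by simp
    qed
    ultimately have "generated H \<subseteq> S - {s}" by (rule hull_minimal)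
    then show False using H s by (auto simp: I_def)
  qed
  show ?thesis
  proof (rule ex1I)
    show "minimal_generating_set S I"
      unfolding minimal_generating_set_def using gen least by blast
    show "G = I" if "minimal_generating_set S G" for G
      using that gen least unfolding minimal_generating_set_def by blast
  qed
qed

definition minimal_generators :: "nat set \<Rightarrow> nat set" where
  "minimal_generators S = (THE G. minimal_generating_set S G)"

definition right_generators :: "nat set \<Rightarrow> nat set" where
  "right_generators S = minimal_generators S - left_elements S"

definition omega :: "nat set \<Rightarrow> nat" where
  "omega S = Gcd (left_elements S)"

text \<open>The division is exact, since \<^term>\<open>omega S\<close> divides every left element.
  The two notions \<^const>\<open>omega\<close> and \<open>shrinking\<close> are only meaningful for non-ordinary \<open>S\<close>;
  for ordinary \<open>S\<close> the only possible left element is \<open>0\<close>.\<close>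

definition shrinking :: "nat set \<Rightarrow> nat set" where
  "shrinking S = generated ((\<lambda>l. l div omega S) ` left_elements S)"

end

theory Submission
  imports Defs "HOL-Number_Theory.Cong"
begin

text \<open>
  Removing \<open>\<sigma>\<close>, which is at least the conductor \<open>c\<close>, makes \<open>\<sigma>\<close> the new Frobenius number, so
  the left elements grow from \<open>L\<close> to \<open>L \<union> {c..<\<sigma>}\<close>; the new elements are none, one, or several
  consecutive numbers according to the three cases. Passing to generated monoids turns the
  union into a sum, and dividing by the new gcd \<open>\<omega>'\<close> instead of \<open>\<omega>\<close> rescales the old part
  by \<open>\<omega> div \<omega>'\<close>. This gives the formula for the new shrinking in all cases at once
  (\<open>shrinking_extend_left_elements\<close>).

  Both bounds on the conductor come from one principle (\<open>conductor_sum_le\<close>): if a set \<open>M\<close>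
  represents every residue class modulo \<open>a\<close> by some element at most \<open>N\<close>, then \<open>aS + M\<close> contains
  every \<open>n \<ge> a c(S) + N - (a - 1)\<close>, since subtracting from \<open>n\<close> the representative of its class
  leaves a multiple of \<open>a\<close> exceeding \<open>a c(S) - a\<close>, hence \<open>a\<close> times an element of \<open>S\<close>.
  For the multiples of a number \<open>b\<close> coprime to \<open>a\<close> the representatives are
  \<open>0, b, \<dots>, (a - 1) b\<close>. For the monoid generated by \<open>{c..c + k}\<close> they are \<open>a\<close> consecutive
  numbers starting at \<open>m c\<close>, as soon as \<open>m k \<ge> a - 1\<close>.
\<close>

section \<open>Generated submonoids\<close>

lemma nat_submonoidI:
  "0 \<in> S \<Longrightarrow> (\<And>a b. a \<in> S \<Longrightarrow> b \<in> S \<Longrightarrow> a + b \<in> S) \<Longrightarrow> nat_submonoid S"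
  by (simp add: nat_submonoid_def)

lemma nat_submonoid_generated: "nat_submonoid (generated A)"
  by (simp add: nat_submonoid_def zero_in_generated add_in_generated)

lemma nat_submonoid_mult:
  assumes "nat_submonoid S" "s \<in> S"
  shows "k * s \<in> S"
  using assms by (induction k) (auto simp: nat_submonoid_def)

lemma generated_Un: "generated (A \<union> B) = generated A + generated B"
proof (rule equalityI)
  have "A \<union> B \<subseteq> generated A + generated B"
  proof
    fix x assume "x \<in> A \<union> B"
    then have "x + 0 \<in> generated A + generated B \<or> 0 + x \<in> generated A + generated B"
      by (blast intro: set_plus_intro hull_inc zero_in_generated)
    then show "x \<in> generated A + generated B" by simp
  qed
  moreover have "nat_submonoid (generated A + generated B)"
  proof (rule nat_submonoidI)
    show "0 \<in> generated A + generated B"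
      using set_plus_intro[OF zero_in_generated zero_in_generated, of A B] by simp
  next
    fix x y assume "x \<in> generated A + generated B" "y \<in> generated A + generated B"
    then obtain a b a' b' where ab: "a \<in> generated A" "b \<in> generated B" "x = a + b"
        "a' \<in> generated A" "b' \<in> generated B" "y = a' + b'"
      by (auto elim!: set_plus_elim)
    then have "(a + a') + (b + b') \<in> generated A + generated B"
      by (intro set_plus_intro add_in_generated)
    then show "x + y \<in> generated A + generated B" using ab by (simp add: algebra_simps)
  qed
  ultimately show "generated (A \<union> B) \<subseteq> generated A + generated B" by (rule hull_minimal)
  have "generated A \<subseteq> generated (A \<union> B)" "generated B \<subseteq> generated (A \<union> B)"
    by (simp_all add: hull_mono)
  then show "generated A + generated B \<subseteq> generated (A \<union> B)"
    by (auto elim!: set_plus_elim intro!: add_in_generated)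
qed

lemma generated_scale: "generated ((\<lambda>x. d * x) ` A) = d *o generated A"
proof (rule equalityI)
  have "(\<lambda>x. d * x) ` A \<subseteq> d *o generated A"
    by (auto intro!: set_times_intro2 hull_inc)
  moreover have "nat_submonoid (d *o generated A)"
  proof (rule nat_submonoidI)
    show "0 \<in> d *o generated A"
      using set_times_intro2[OF zero_in_generated, of d A] by simp
  next
    fix x y assume "x \<in> d *o generated A" "y \<in> d *o generated A"
    then obtain a b where "a \<in> generated A" "b \<in> generated A" "x = d * a" "y = d * b"
      by (auto simp: elt_set_times_def)
    then show "x + y \<in> d *o generated A"
      using set_times_intro2[OF add_in_generated, of a A b d] by (simp add: distrib_left)
  qed
  ultimately show "generated ((\<lambda>x. d * x) ` A) \<subseteq> d *o generated A" by (rule hull_minimal)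
  have "generated A \<subseteq> {x. d * x \<in> generated ((\<lambda>x. d * x) ` A)}"
    by (rule hull_minimal)
      (auto simp: nat_submonoid_def zero_in_generated add_in_generated distrib_left intro: hull_inc)
  then show "d *o generated A \<subseteq> generated ((\<lambda>x. d * x) ` A)"
    by (auto simp: elt_set_times_def)
qed

lemma generated_singleton: "generated {b} = b *o UNIV"
proof -
  have "n \<in> generated {1}" for n
    using nat_submonoid_mult[OF nat_submonoid_generated hull_inc[OF singletonI], of n 1] by simp
  then have "generated {1} = UNIV" by auto
  then show ?thesis using generated_scale[of b "{1}"] by simp
qed

lemma generated_interval:
  assumes "i \<le> m * k"
  shows "m * c + i \<in> generated {c..c + k}"
  using assms
proof (induction m arbitrary: i)
  case 0
  then show ?case by (simp add: zero_in_generated)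
next
  case (Suc m)
  have "m * c + (i - min i k) \<in> generated {c..c + k}"
    using Suc.prems by (intro Suc.IH) auto
  moreover have "c + min i k \<in> generated {c..c + k}"
    by (rule hull_inc) auto
  ultimately have "(m * c + (i - min i k)) + (c + min i k) \<in> generated {c..c + k}"
    by (rule add_in_generated)
  moreover have "(m * c + (i - min i k)) + (c + min i k) = Suc m * c + i" by auto
  ultimately show ?case by (simp only:)
qed

section \<open>Cofiniteness and conductors\<close>

text \<open>
  The least positive difference of two elements of \<open>S\<close> divides every element of \<open>S\<close>, so it is
  \<open>1\<close>. Given neighbours \<open>x, x + 1 \<in> S\<close>, a number \<open>q x + r\<close> with \<open>r \<le> q\<close> is
  \<open>(q - r) x + r (x + 1)\<close>.
\<close>

lemma nat_submonoid_cofinite: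
  assumes S: "nat_submonoid S" and gcd: "Gcd S = 1"
  shows "\<exists>C. \<forall>n\<ge>C. n \<in> S"
proof -
  define P where "P d \<longleftrightarrow> d > 0 \<and> (\<exists>x\<in>S. x + d \<in> S)" for d
  define d where "d = (LEAST d. P d)"
  have "\<exists>s\<in>S. s > 0" using gcd Gcd_0_iff[of S] by auto
  moreover have "0 \<in> S" using S by (simp add: nat_submonoid_def)
  ultimately have "\<exists>d. P d" unfolding P_def by (metis add_0)
  then have Pd: "P d" unfolding d_def by (rule LeastI_ex)
  have min: "d \<le> e" if "P e" for e unfolding d_def using that by (rule Least_le)
  obtain x where x: "x \<in> S" "x + d \<in> S" using Pd by (auto simp: P_def)
  have "d dvd s" if s: "s \<in> S" for s
  proof (rule ccontr)
    assume "\<not> d dvd s"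
    then have r: "s mod d > 0" by (simp add: dvd_eq_mod_eq_0)
    \<comment> \<open>The remainder is itself a difference: \<open>q (x + d) + (s - q d) = q x + s\<close>.\<close>
    define q where "q = s div d"
    have "q * (x + d) \<in> S" "q * x + s \<in> S"
      using x s S nat_submonoid_mult[OF S] by (auto simp: nat_submonoid_def)
    moreover have "q * (x + d) + s mod d = q * x + s"
      using div_mult_mod_eq[of s d] by (simp add: q_def algebra_simps)
    ultimately have "P (s mod d)" using r unfolding P_def by metis
    moreover have "s mod d < d" using Pd by (simp add: P_def)
    ultimately show False using min by fastforce
  qed
  then have "d dvd Gcd S" by (rule Gcd_greatest)
  then have x1: "x + 1 \<in> S" using x gcd by simp
  have "n \<in> S" if n: "n \<ge> x * x" for n
  proof (cases "x = 0")
    case True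
    then show ?thesis using nat_submonoid_mult[OF S x1, of n] by simp
  next
    case False
    define q r where "q = n div x" and "r = n mod x"
    have "x \<le> q" using div_le_mono[OF n, of x] False by (simp add: q_def)
    moreover have "r < x" using False by (simp add: r_def)
    ultimately have "r \<le> q" by simp
    have "(q - r) * x + r * (x + 1) = (q - r + r) * x + r"
      by (simp add: algebra_simps)
    also have "\<dots> = n" using \<open>r \<le> q\<close> by (simp add: q_def r_def)
    finally have "(q - r) * x + r * (x + 1) = n" .
    moreover have "(q - r) * x + r * (x + 1) \<in> S"
      using S x x1 nat_submonoid_mult[OF S] unfolding nat_submonoid_def by blast
    ultimately show ?thesis by simp
  qed
  then show ?thesis by blast
qed

lemma conductor_le: "(\<And>n. n \<ge> k \<Longrightarrow> n \<in> S) \<Longrightarrow> conductor S \<le> k"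
  unfolding conductor_def by (rule Least_le) blast

lemma conductor_mem:
  assumes "\<exists>C. \<forall>n\<ge>C. n \<in> S" "n \<ge> conductor S"
  shows "n \<in> S"
  using LeastI_ex[OF assms(1)] assms(2) unfolding conductor_def by blast

lemma pred_conductor_notin:
  assumes "\<exists>C. \<forall>n\<ge>C. n \<in> S" "S \<noteq> UNIV"
  shows "conductor S > 0" "conductor S - 1 \<notin> S"
proof -
  show pos: "conductor S > 0"
    using conductor_mem[OF assms(1)] assms(2) by auto
  show "conductor S - 1 \<notin> S"
  proof
    assume "conductor S - 1 \<in> S"
    then have "n \<in> S" if "n \<ge> conductor S - 1" for n
      using conductor_mem[OF assms(1), of n] that by (cases "n = conductor S - 1") auto
    then have "conductor S \<le> conductor S - 1" by (rule conductor_le)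
    with pos show False by simp
  qed
qed

text \<open>
  The remainder after subtracting from \<open>n\<close> the representative of its class is a multiple of
  \<open>a\<close> that is at least \<open>a c(S) - (a - 1)\<close>; being a multiple of \<open>a\<close>, it is at least \<open>a c(S)\<close>.
  This rounding is what saves the term \<open>a - 1\<close>.
\<close>

lemma conductor_sum_le:
  fixes S M :: "nat set"
  assumes cofin: "\<exists>C. \<forall>n\<ge>C. n \<in> S" and a: "a > 0"
    and res: "\<And>n. \<exists>t\<in>M. t \<le> N \<and> [t = n] (mod a)"
  shows "int (conductor (a *o S + M)) \<le> int (conductor S) * int a + int N - (int a - 1)"
proof -
  define C where "C = conductor S"
  \<comment> \<open>The class of \<open>a - 1\<close> has a representative, so \<open>N \<ge> a - 1\<close> and subtraction is exact.\<close>
  obtain t0 where "t0 \<le> N" "[t0 = a - 1] (mod a)" using res by blast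
  moreover from this have "a - 1 = t0 mod a" using a by (simp add: cong_def)
  ultimately have N: "a - 1 \<le> N" by (metis le_trans mod_less_eq_dividend)
  have "conductor (a *o S + M) \<le> C * a + N - (a - 1)"
  proof (rule conductor_le)
    fix n assume n: "n \<ge> C * a + N - (a - 1)"
    obtain t where t: "t \<in> M" "t \<le> N" "[t = n] (mod a)" using res by blast
    then have "int a dvd int n - int t"
      by (metis cong_iff_dvd_diff cong_int_iff cong_sym)
    then obtain q where q: "int n - int t = int a * q" by blast
    have "int n - int t \<ge> int C * int a + 1 - int a"
      using n t N a by (simp flip: of_nat_mult)
    then have "int a * (int C - 1) < int a * q" using q by (simp add: algebra_simps)
    then have qC: "q \<ge> int C" using a by simp
    then have "nat q \<in> S"
      by (intro conductor_mem[OF cofin]) (simp add: C_def nat_le_iff le_nat_iff)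
    moreover have "n = a * nat q + t"
    proof -
      have "int n = int (a * nat q + t)" using q qC by simp
      then show ?thesis by (simp only: of_nat_eq_iff)
    qed
    ultimately show "n \<in> a *o S + M"
      using t by (auto intro!: set_plus_intro set_times_intro2)
  qed
  then have "int (conductor (a *o S + M)) \<le> int (C * a + N - (a - 1))"
    by (simp only: of_nat_le_iff)
  also have "\<dots> = int C * int a + int N - (int a - 1)"
    using N a by (simp add: of_nat_diff)
  finally show ?thesis by (simp add: C_def)
qed

lemma multiples_represent_residues:
  fixes a b :: nat
  assumes "coprime a b" "a > 0"
  shows "\<exists>t\<in>b *o UNIV. t \<le> b * (a - 1) \<and> [t = n] (mod a)"
proof -
  obtain b' where b': "[b * b' = 1] (mod a)"
    using assms cong_solve_coprime_nat[of b a] by (auto simp: coprime_commute)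
  define y where "y = (b' * n) mod a"
  have "[b * y = b * (b' * n)] (mod a)" by (simp add: y_def cong_def mod_mult_right_eq)
  also have "[b * (b' * n) = n] (mod a)"
    using cong_scalar_right[OF b', of n] by (simp add: mult.assoc)
  finally have "[b * y = n] (mod a)" .
  moreover have "y \<le> a - 1" using assms(2) by (simp add: y_def less_Suc_eq_le[symmetric])
  ultimately show ?thesis by (intro bexI[of _ "b * y"]) (auto intro: set_times_intro2)
qed

text \<open>
  Sums of \<open>m\<close> elements of \<open>{c..c + k}\<close> fill the interval from \<open>m * c\<close> to \<open>m * c + m * k\<close>.
  By the assumption on \<open>m * k\<close>, it contains \<open>a\<close> consecutive numbers.
\<close>

lemma interval_represents_residues:
  fixes a :: nat
  assumes "a > 0" "a - 1 \<le> m * k"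
  shows "\<exists>t\<in>generated {c..c + k}. t \<le> m * c + (a - 1) \<and> [t = n] (mod a)"
proof -
  define r where "r = nat ((int n - int (m * c)) mod int a)"
  have r: "int r = (int n - int (m * c)) mod int a" using assms by (simp add: r_def)
  then have "int r < int a" using assms by simp
  then have "r \<le> a - 1" by simp
  moreover from this have "m * c + r \<in> generated {c..c + k}"
    using assms by (intro generated_interval) simp
  moreover have "[int (m * c + r) = int n] (mod int a)"
    using r by (simp add: cong_def mod_simps)
  ultimately show ?thesis
    unfolding cong_int_iff by (intro bexI[of _ "m * c + r"]) auto
qed

section \<open>Left elements and shrinking\<close>

lemma left_elements_eq:
  assumes "f \<notin> S" "\<And>n. n > f \<Longrightarrow> n \<in> S"
  shows "left_elements S = {s \<in> S. s < f}"
proof -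
  have sub: "UNIV - S \<subseteq> {..f}" using assms(2) by (auto simp flip: not_less)
  then have "finite (UNIV - S)" by (rule finite_subset) simp
  then have "Max (UNIV - S) = f" using assms(1) sub by (intro Max_eqI) auto
  then have "frobenius S = int f" using assms(1) by (auto simp: frobenius_def)
  then show ?thesis by (simp add: left_elements_def)
qed

lemma minimal_generators_subset:
  assumes "nat_submonoid S"
  shows "minimal_generators S \<subseteq> S"
proof -
  have "minimal_generating_set S (minimal_generators S)"
    unfolding minimal_generators_def by (rule theI'[OF ex1_minimal_generating_set[OF assms]])
  then show ?thesis
    using hull_subset[of "minimal_generators S" nat_submonoid]
    by (simp add: minimal_generating_set_def)
qed

lemma Gcd_Un: "Gcd (A \<union> B) = gcd (Gcd A) (Gcd B)" for A B :: "nat set"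
  by (rule dvd_antisym)
    (auto simp: dvd_Gcd_iff intro: Gcd_dvd dvd_trans[OF gcd_dvd1] dvd_trans[OF gcd_dvd2])

text \<open>
  A common divisor of the quotients \<open>l div omega S\<close>, multiplied by \<open>omega S\<close>, divides all left
  elements, so it cannot exceed \<open>1\<close>. Thus the shrinking is cofinite and its conductor is a
  genuine minimum, not the least element of an empty set.
\<close>

lemma Gcd_shrinking:
  assumes "omega S > 0"
  shows "Gcd (shrinking S) = 1"
proof -
  define g where "g = Gcd (shrinking S)"
  have "g * omega S dvd l" if "l \<in> left_elements S" for l
  proof -
    have "l div omega S \<in> shrinking S"
      unfolding shrinking_def using that by (intro hull_inc) simp
    then have "g dvd l div omega S" unfolding g_def by (rule Gcd_dvd)
    moreover have "omega S dvd l" unfolding omega_def using that by (rule Gcd_dvd)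
    ultimately show ?thesis by (metis dvd_div_mult_self mult_dvd_mono dvd_refl)
  qed
  then have "g * omega S dvd omega S"
    unfolding omega_def[of S] by (intro Gcd_greatest) simp
  then show ?thesis using assms by (simp add: g_def)
qed

lemma shrinking_cofinite: "omega S > 0 \<Longrightarrow> \<exists>C. \<forall>n\<ge>C. n \<in> shrinking S"
  using nat_submonoid_cofinite[OF _ Gcd_shrinking] nat_submonoid_generated
  by (simp add: shrinking_def)

text \<open>
  Every old left element \<open>l\<close> is a multiple of \<open>omega S\<close>, and \<open>omega T\<close> divides \<open>omega S\<close>.
  Hence \<open>l div omega T\<close> is \<open>l div omega S\<close> times the constant \<open>omega S div omega T\<close>, and
  the generators coming from \<open>S\<close> are the old ones rescaled.
\<close>

lemma shrinking_extend_left_elements: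
  assumes ext: "left_elements T = left_elements S \<union> D" and pos: "omega S > 0"
  shows "shrinking T =
    (omega S div omega T) *o shrinking S + generated ((\<lambda>l. l div omega T) ` D)"
proof -
  have dvd: "omega T dvd omega S" unfolding omega_def ext by (simp add: Gcd_Un)
  have "l div omega T = omega S div omega T * (l div omega S)" if "l \<in> left_elements S" for l
  proof -
    have "omega S dvd l" unfolding omega_def using that by (rule Gcd_dvd)
    then have "l = omega S * (l div omega S)" by simp
    then show ?thesis using dvd by (metis div_mult_swap mult.commute)
  qed
  then have "(\<lambda>l. l div omega T) ` left_elements S =
      (\<lambda>x. omega S div omega T * x) ` (\<lambda>l. l div omega S) ` left_elements S"
    by (simp add: image_image cong: image_cong)
  then show ?thesis
    by (simp add: shrinking_def[of T] ext image_Un generated_Un generated_scale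
        shrinking_def[of S])
qed

section \<open>Removing a right generator\<close>

theorem lemma3p3:
  fixes \<Lambda> \<Lambda>' :: "nat set" and c \<sigma> \<omega> \<omega>' :: nat
  assumes "numerical_semigroup \<Lambda>"
    and "\<not> ordinary \<Lambda>"
    and "c = conductor \<Lambda>"
    and "\<sigma> \<in> right_generators \<Lambda>"
    and "\<Lambda>' = \<Lambda> - {\<sigma>}"
    and "\<omega> = omega \<Lambda>"
    and "\<omega>' = omega \<Lambda>'"
  shows "(\<sigma> = c \<longrightarrow>
            \<omega>' = \<omega> \<and>
            shrinking \<Lambda>' = shrinking \<Lambda> \<and>
            conductor (shrinking \<Lambda>') = conductor (shrinking \<Lambda>)) \<and>
         (\<sigma> = c + 1 \<longrightarrow>
            \<omega>' = gcd \<omega> c \<and>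
            shrinking \<Lambda>' = (\<omega> div \<omega>') *o shrinking \<Lambda> + (c div \<omega>') *o UNIV \<and>
            int (conductor (shrinking \<Lambda>'))
              \<le> int (conductor (shrinking \<Lambda>)) * int (\<omega> div \<omega>')
                 + (int (c div \<omega>') - 1) * (int (\<omega> div \<omega>') - 1)) \<and>
         (\<sigma> > c + 1 \<longrightarrow>
            \<omega>' = 1 \<and>
            shrinking \<Lambda>' = \<omega> *o shrinking \<Lambda> + generated {c..\<sigma> - 1} \<and>
            int (conductor (shrinking \<Lambda>'))
              \<le> int (conductor (shrinking \<Lambda>)) * int \<omega>
                 + (\<lfloor>(rat_of_nat \<omega> - 2) / (rat_of_nat \<sigma> - rat_of_nat c - 1)\<rfloor> + 1) * int c)"
proof -
  have sub: "nat_submonoid \<Lambda>" and fin: "finite (UNIV - \<Lambda>)"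
    using assms(1) by (auto simp: numerical_semigroup_def)
  have cofin: "\<exists>C. \<forall>n\<ge>C. n \<in> \<Lambda>"
  proof -
    obtain m where "\<forall>n\<in>UNIV - \<Lambda>. n < m" using fin by (metis finite_nat_set_iff_bounded)
    then show ?thesis by (intro exI[of _ m]) (auto simp flip: not_le)
  qed
  have "(UNIV :: nat set) = {0} \<union> {1..}" by auto
  then have "\<Lambda> \<noteq> UNIV" using assms(2) by (auto simp only: ordinary_def)
  then have c0: "c > 0" and c1: "c - 1 \<notin> \<Lambda>"
    using pred_conductor_notin[OF cofin] assms(3) by auto
  have mem: "n \<in> \<Lambda>" if "n \<ge> c" for n using conductor_mem[OF cofin] that assms(3) by simp
  have "left_elements \<Lambda> = {s \<in> \<Lambda>. s < c - 1}"
    using c0 c1 mem by (intro left_elements_eq) auto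
  \<comment> \<open>The bound may be moved up to \<open>c\<close>, because \<open>c - 1\<close> is a gap.\<close>
  also have "\<dots> = {s \<in> \<Lambda>. s < c}"
  proof -
    have "s < c - 1 \<longleftrightarrow> s < c" if "s \<in> \<Lambda>" for s
    proof -
      have "s \<noteq> c - 1" using that c1 by blast
      then show ?thesis using c0 by linarith
    qed
    then show ?thesis by blast
  qed
  finally have L: "left_elements \<Lambda> = {s \<in> \<Lambda>. s < c}" .
  have "\<sigma> \<in> \<Lambda>" "\<sigma> \<notin> left_elements \<Lambda>"
    using assms(4) minimal_generators_subset[OF sub] by (auto simp: right_generators_def)
  then have sc: "\<sigma> \<ge> c" by (simp add: L)
  have "left_elements \<Lambda>' = {s \<in> \<Lambda>'. s < \<sigma>}"
    using sc mem assms(5) by (intro left_elements_eq) auto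
  also have "\<dots> = left_elements \<Lambda> \<union> {c..<\<sigma>}"
    using sc mem assms(5) by (auto simp: L)
  finally have L': "left_elements \<Lambda>' = left_elements \<Lambda> \<union> {c..<\<sigma>}" .
  \<comment> \<open>Without a positive left element \<open>\<Lambda>\<close> would be ordinary; this makes \<open>\<omega>\<close> nonzero.\<close>
  have pos: "\<omega> > 0"
  proof (rule ccontr)
    assume "\<not> \<omega> > 0"
    then have "left_elements \<Lambda> \<subseteq> {0}" by (simp add: assms(6) omega_def)
    moreover have "0 \<in> \<Lambda>" using sub by (simp add: nat_submonoid_def)
    ultimately have "\<Lambda> = {0} \<union> {c..}" using mem by (fastforce simp: L)
    moreover have "c \<ge> 1" using c0 by simp
    ultimately have "ordinary \<Lambda>" unfolding ordinary_def by blast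
    then show False using assms(2) by blast
  qed
  note cof = shrinking_cofinite[OF pos[unfolded assms(6)]]
  have \<omega>': "\<omega>' = gcd \<omega> (Gcd {c..<\<sigma>})" by (simp add: assms(6,7) omega_def L' Gcd_Un)
  have shr: "shrinking \<Lambda>' =
      (\<omega> div \<omega>') *o shrinking \<Lambda> + generated ((\<lambda>l. l div \<omega>') ` {c..<\<sigma>})"
    using shrinking_extend_left_elements[OF L'] pos by (simp add: assms(6,7))
  show ?thesis
  proof (intro conjI impI)
    assume "\<sigma> = c"
    then have eq: "left_elements \<Lambda>' = left_elements \<Lambda>" using L' by simp
    then show "\<omega>' = \<omega>" by (simp add: assms(6,7) omega_def)
    show "shrinking \<Lambda>' = shrinking \<Lambda>" by (simp add: shrinking_def omega_def eq)
    then show "conductor (shrinking \<Lambda>') = conductor (shrinking \<Lambda>)" by simp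
  next
    assume "\<sigma> = c + 1"
    then have int: "{c..<\<sigma>} = {c}" by auto
    show g: "\<omega>' = gcd \<omega> c" using \<omega>' int by simp
    show eq: "shrinking \<Lambda>' = (\<omega> div \<omega>') *o shrinking \<Lambda> + (c div \<omega>') *o UNIV"
      using shr int by (simp add: generated_singleton)
    have ap: "\<omega> div \<omega>' > 0" using pos g by (simp add: div_greater_zero_iff gcd_le1_nat)
    have "coprime (\<omega> div \<omega>') (c div \<omega>')" using pos g div_gcd_coprime[of \<omega> c] by simp
    then have "int (conductor (shrinking \<Lambda>')) \<le> int (conductor (shrinking \<Lambda>)) * int (\<omega> div \<omega>')
        + int (c div \<omega>' * (\<omega> div \<omega>' - 1)) - (int (\<omega> div \<omega>') - 1)"
      unfolding eq by (intro conductor_sum_le cof ap multiples_represent_residues)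
    also have "\<dots> = int (conductor (shrinking \<Lambda>)) * int (\<omega> div \<omega>')
        + (int (c div \<omega>') - 1) * (int (\<omega> div \<omega>') - 1)"
      using ap by (simp only: of_nat_mult of_nat_diff Suc_le_eq One_nat_def) (simp add: algebra_simps)
    finally show "int (conductor (shrinking \<Lambda>'))
        \<le> int (conductor (shrinking \<Lambda>)) * int (\<omega> div \<omega>')
          + (int (c div \<omega>') - 1) * (int (\<omega> div \<omega>') - 1)" .
  next
    assume s: "\<sigma> > c + 1"
    define k where "k = \<sigma> - c - 1"
    have k: "k > 0" "\<sigma> = c + k + 1" using s by (auto simp: k_def)
    have "\<omega>' dvd c" "\<omega>' dvd c + 1"
      using s unfolding assms(7) omega_def L' by (auto intro!: Gcd_dvd)
    then show one: "\<omega>' = 1" by (metis dvd_add_right_iff nat_dvd_1_iff_1)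
    have int: "{c..<\<sigma>} = {c..c + k}" "{c..\<sigma> - 1} = {c..c + k}" using k by auto
    show eq: "shrinking \<Lambda>' = \<omega> *o shrinking \<Lambda> + generated {c..\<sigma> - 1}"
      using shr one int by simp
    define x where "x = (rat_of_nat \<omega> - 2) / (rat_of_nat \<sigma> - rat_of_nat c - 1)"
    have x: "x = (rat_of_nat \<omega> - 2) / rat_of_nat k" using k by (simp add: x_def)
    \<comment> \<open>\<open>m\<close> is the rounded-up quotient of \<open>\<omega> - 1\<close> by \<open>k\<close>. For \<open>\<omega> = 1\<close> the floor is \<open>-1\<close>,
      so \<open>m\<close> is never negative.\<close>
    define m where "m = nat (\<lfloor>x\<rfloor> + 1)"
    have "x \<ge> -1" using pos k by (simp add: x field_simps)
    then have "\<lfloor>x\<rfloor> \<ge> -1" by (simp add: le_floor_iff)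
    then have m: "int m = \<lfloor>x\<rfloor> + 1" by (simp add: m_def)
    have "x < of_int (\<lfloor>x\<rfloor> + 1)" by linarith
    then have "x < rat_of_nat m" using m by (metis of_int_of_nat_eq)
    then have "rat_of_nat \<omega> < rat_of_nat (m * k + 2)" using k by (simp add: x field_simps)
    then have mk: "\<omega> - 1 \<le> m * k" by (simp only: of_nat_less_iff)
    have "int (conductor (shrinking \<Lambda>'))
        \<le> int (conductor (shrinking \<Lambda>)) * int \<omega> + int (m * c + (\<omega> - 1)) - (int \<omega> - 1)"
      unfolding eq int(2)
      by (intro conductor_sum_le cof pos interval_represents_residues mk)
    also have "\<dots> = int (conductor (shrinking \<Lambda>)) * int \<omega> + (\<lfloor>x\<rfloor> + 1) * int c"
      using pos by (simp add: of_nat_diff m)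
    finally show "int (conductor (shrinking \<Lambda>')) \<le> int (conductor (shrinking \<Lambda>)) * int \<omega>
        + (\<lfloor>(rat_of_nat \<omega> - 2) / (rat_of_nat \<sigma> - rat_of_nat c - 1)\<rfloor> + 1) * int c"
      by (simp add: x_def)
  qed
qed

end
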